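(* Let $x_0\in(0,1)$ and let $p\in C([0,1])$ with $p>0$ on $[0,1]\setminus\{x_0\}$, $p(x_0)=0$, and suppose there exists $q>1$ such that $x\mapsto p(x)/|x-x_0|^q$ is non increasing on the left of $x_0$ and non decreasing on the right of $x_0$. Then there exists a constant $C_{HP}>0$ such that for every function $w$, locally absolutely continuous on $[0,x_0)\cup(x_0,1]$, satisfying $w'(0)=w'(1)=0$ and $\int_0^1|w'(x)|^2dx<+\infty$, one has \[ \int_0^1\frac{p(x)}{(x-x_0)^2}w^2(x)\,dx\le C_{HP}\int_0^1p(x)|w'(x)|^2dx+2\Xi\Big[w^2(1)\frac{p(1)}{(1-x_0)^q}+w^2(0)\frac{p(0)}{x_0^q}\Big], \] where $\Xi:=\max\Big\{\frac{(1-x_0)^{q-1}}{q-1},\frac{1}{q-1}\Big\}$. *)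

theory Defs
  imports "HOL-Analysis.Analysis"
begin

text \<open>Absolute continuity of a real function on the compact interval [a,b]
  (classical epsilon-delta definition with finitely many non-overlapping subintervals).\<close>
definition abs_continuous_on :: "(real \<Rightarrow> real) \<Rightarrow> real \<Rightarrow> real \<Rightarrow> bool" where
  "abs_continuous_on f a b \<longleftrightarrow>
     (\<forall>e>0. \<exists>d>0. \<forall>(n::nat) (l::nat \<Rightarrow> real) (r::nat \<Rightarrow> real).
        (\<forall>i<n. a \<le> l i \<and> l i \<le> r i \<and> r i \<le> b) \<and>
        (\<forall>i<n. \<forall>j<n. i \<noteq> j \<longrightarrow> r i \<le> l j \<or> r j \<le> l i) \<and>
        (\<Sum>i<n. r i - l i) < d
        \<longrightarrow> (\<Sum>i<n. \<bar>f (r i) - f (l i)\<bar>) < e)"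

text \<open>Local absolute continuity on [0,x0) \<union> (x0,1]: absolute continuity on every
  compact subinterval of [0,x0) and of (x0,1].\<close>
definition loc_abs_continuous_punctured :: "(real \<Rightarrow> real) \<Rightarrow> real \<Rightarrow> bool" where
  "loc_abs_continuous_punctured f x0 \<longleftrightarrow>
     (\<forall>a b. (0 \<le> a \<and> b < x0) \<or> (x0 < a \<and> b \<le> 1) \<longrightarrow> abs_continuous_on f a b)"

end

theory Submission
  imports Defs
begin

text \<open>On each side of \<open>x0\<close> the inequality is a weighted Hardy inequality. On \<open>[s, x0)\<close> the
  function \<open>r x = p x / (x0 - x) powr q\<close> is non-increasing. Writing \<open>w x = w s + \<integral>\<^sub>s\<^sup>x w'\<close> and
  applying Cauchy--Schwarz with the weight \<open>(x0 - t) powr a\<close>, \<open>a = (q + 1) / 2\<close>, gives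
  \<open>(w x)\<^sup>2 \<le> 2 (w s)\<^sup>2 + 2 (x0 - x) powr (1 - a) / (a - 1) \<integral>\<^sub>s\<^sup>x (x0 - t) powr a (w' t)\<^sup>2\<close>.
  Multiplying by \<open>p x / (x - x0)\<^sup>2 = r x (x0 - x) powr (q - 2)\<close>, using \<open>r x \<le> r t\<close> for \<open>t \<le> x\<close> and
  integrating over \<open>x\<close> with Tonelli's theorem, the first term yields the boundary term and the
  second yields \<open>8 / (q - 1)\<^sup>2 \<integral> p (w')\<^sup>2\<close>. The right half follows by the reflection \<open>x \<mapsto> -x\<close>.

  Since \<open>w\<close> is only differentiable almost everywhere, the fundamental theorem of calculus is
  replaced by the estimate \<open>\<bar>w x - w s\<bar> \<le> \<integral>\<^sub>s\<^sup>x \<bar>w'\<bar>\<close>, obtained from the one-dimensional area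
  formula and Luzin's property (N) of absolutely continuous functions.\<close>

section \<open>Absolute continuity\<close>

lemma abs_continuous_onE:
  assumes "abs_continuous_on f a b" "e > 0"
  obtains d where "d > 0" "\<And>(n::nat) l r. (\<forall>i<n. a \<le> l i \<and> l i \<le> r i \<and> r i \<le> b) \<Longrightarrow>
      (\<forall>i<n. \<forall>j<n. i \<noteq> j \<longrightarrow> r i \<le> l j \<or> r j \<le> l i) \<Longrightarrow>
      (\<Sum>i<n. r i - l i) < d \<Longrightarrow> (\<Sum>i<n. \<bar>f (r i) - f (l i)\<bar>) < e"
proof -
  from assms obtain d where "d > 0" and H: "\<forall>(n::nat) l r. (\<forall>i<n. a \<le> l i \<and> l i \<le> r i \<and> r i \<le> b) \<and>
      (\<forall>i<n. \<forall>j<n. i \<noteq> j \<longrightarrow> r i \<le> l j \<or> r j \<le> l i) \<and>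
      (\<Sum>i<n. r i - l i) < d \<longrightarrow> (\<Sum>i<n. \<bar>f (r i) - f (l i)\<bar>) < e"
    unfolding abs_continuous_on_def by auto
  show thesis
    by (rule that[OF \<open>d > 0\<close>]) (use H in blast)
qed

lemma abs_continuous_onE_finite:
  assumes "abs_continuous_on f a b" "e > 0"
  obtains d where "d > 0" "\<And>(I::'i set) l r. finite I \<Longrightarrow> (\<forall>i\<in>I. a \<le> l i \<and> l i \<le> r i \<and> r i \<le> b) \<Longrightarrow>
      (\<forall>i\<in>I. \<forall>j\<in>I. i \<noteq> j \<longrightarrow> r i \<le> l j \<or> r j \<le> l i) \<Longrightarrow>
      (\<Sum>i\<in>I. r i - l i) < d \<Longrightarrow> (\<Sum>i\<in>I. \<bar>f (r i) - f (l i)\<bar>) < e"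
proof -
  obtain d where d: "d > 0" and H: "\<And>(n::nat) l r. (\<forall>i<n. a \<le> l i \<and> l i \<le> r i \<and> r i \<le> b) \<Longrightarrow>
      (\<forall>i<n. \<forall>j<n. i \<noteq> j \<longrightarrow> r i \<le> l j \<or> r j \<le> l i) \<Longrightarrow>
      (\<Sum>i<n. r i - l i) < d \<Longrightarrow> (\<Sum>i<n. \<bar>f (r i) - f (l i)\<bar>) < e"
    using abs_continuous_onE[OF assms] by blast
  have "(\<Sum>i\<in>I. \<bar>f (r i) - f (l i)\<bar>) < e"
    if "finite I" "\<forall>i\<in>I. a \<le> l i \<and> l i \<le> r i \<and> r i \<le> b"
      "\<forall>i\<in>I. \<forall>j\<in>I. i \<noteq> j \<longrightarrow> r i \<le> l j \<or> r j \<le> l i" "(\<Sum>i\<in>I. r i - l i) < d"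
    for I :: "'i set" and l r
  proof -
    obtain h where h: "bij_betw h {..<card I} I"
      using ex_bij_betw_nat_finite[OF \<open>finite I\<close>] lessThan_atLeast0 by metis
    have reindex: "(\<Sum>i\<in>I. g i) = (\<Sum>k<card I. g (h k))" for g :: "'i \<Rightarrow> real"
      using sum.reindex_bij_betw[OF h, of g] by simp
    have hI: "h k \<in> I" if "k < card I" for k
      using h that by (auto simp: bij_betw_def)
    have hinj: "h k \<noteq> h k'" if "k < card I" "k' < card I" "k \<noteq> k'" for k k'
      using h that by (auto simp: bij_betw_def inj_on_def)
    have "(\<Sum>k<card I. \<bar>f ((r \<circ> h) k) - f ((l \<circ> h) k)\<bar>) < e"
    proof (rule H)
      show "\<forall>k<card I. a \<le> (l \<circ> h) k \<and> (l \<circ> h) k \<le> (r \<circ> h) k \<and> (r \<circ> h) k \<le> b"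
        using hI that(2) by simp
      show "\<forall>k<card I. \<forall>k'<card I. k \<noteq> k' \<longrightarrow> (r \<circ> h) k \<le> (l \<circ> h) k' \<or> (r \<circ> h) k' \<le> (l \<circ> h) k"
        using hI hinj that(3) by simp
      show "(\<Sum>k<card I. (r \<circ> h) k - (l \<circ> h) k) < d"
        using that(4) reindex[of "\<lambda>i. r i - l i"] by simp
    qed
    then show ?thesis
      using reindex[of "\<lambda>i. \<bar>f (r i) - f (l i)\<bar>"] by simp
  qed
  then show thesis
    using d that by blast
qed

lemma abs_continuous_on_imp_continuous_on:
  assumes ac: "abs_continuous_on f a b"
  shows "continuous_on {a..b} f"
  unfolding continuous_on_iff
proof (intro ballI allI impI)
  fix x e :: real assume x: "x \<in> {a..b}" and e: "0 < e"
  obtain d where d: "d > 0" and H: "\<And>(n::nat) (l::nat\<Rightarrow>real) r. (\<forall>i<n. a \<le> l i \<and> l i \<le> r i \<and> r i \<le> b) \<Longrightarrow>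
        (\<forall>i<n. \<forall>j<n. i \<noteq> j \<longrightarrow> r i \<le> l j \<or> r j \<le> l i) \<Longrightarrow>
        (\<Sum>i<n. r i - l i) < d \<Longrightarrow> (\<Sum>i<n. \<bar>f (r i) - f (l i)\<bar>) < e"
    by (rule abs_continuous_onE[OF ac e]) blast
  show "\<exists>d>0. \<forall>x'\<in>{a..b}. dist x' x < d \<longrightarrow> dist (f x') (f x) < e"
  proof (intro exI[of _ d] conjI ballI impI d)
    fix y assume y: "y \<in> {a..b}" and dy: "dist y x < d"
    have "(\<Sum>i<(1::nat). \<bar>f (max x y) - f (min x y)\<bar>) < e"
      using H[of 1 "\<lambda>_. min x y" "\<lambda>_. max x y"] x y dy by (auto simp: dist_real_def)
    then show "dist (f y) (f x) < e"
      by (cases "x \<le> y") (auto simp: dist_real_def max_def min_def abs_minus_commute)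
  qed
qed

lemma abs_continuous_on_reflect:
  assumes ac: "abs_continuous_on f a b"
  shows "abs_continuous_on (\<lambda>x. f (-x)) (-b) (-a)"
  unfolding abs_continuous_on_def
proof (intro allI impI)
  fix e :: real assume e: "e > 0"
  obtain d where d: "d > 0" and H: "\<And>(n::nat) (l::nat\<Rightarrow>real) r. (\<forall>i<n. a \<le> l i \<and> l i \<le> r i \<and> r i \<le> b) \<Longrightarrow>
        (\<forall>i<n. \<forall>j<n. i \<noteq> j \<longrightarrow> r i \<le> l j \<or> r j \<le> l i) \<Longrightarrow>
        (\<Sum>i<n. r i - l i) < d \<Longrightarrow> (\<Sum>i<n. \<bar>f (r i) - f (l i)\<bar>) < e"
    by (rule abs_continuous_onE[OF ac e]) blast
  show "\<exists>d>0. \<forall>(n::nat) (l::nat \<Rightarrow> real) r.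
        (\<forall>i<n. - b \<le> l i \<and> l i \<le> r i \<and> r i \<le> - a) \<and>
        (\<forall>i<n. \<forall>j<n. i \<noteq> j \<longrightarrow> r i \<le> l j \<or> r j \<le> l i) \<and>
        (\<Sum>i<n. r i - l i) < d \<longrightarrow>
        (\<Sum>i<n. \<bar>f (- r i) - f (- l i)\<bar>) < e"
  proof (intro exI[of _ d] conjI allI impI d)
    fix n :: nat and l r :: "nat \<Rightarrow> real"
    assume A: "(\<forall>i<n. - b \<le> l i \<and> l i \<le> r i \<and> r i \<le> - a) \<and>
        (\<forall>i<n. \<forall>j<n. i \<noteq> j \<longrightarrow> r i \<le> l j \<or> r j \<le> l i) \<and>
        (\<Sum>i<n. r i - l i) < d"
    have "(\<Sum>i<n. \<bar>f ((\<lambda>i. - l i) i) - f ((\<lambda>i. - r i) i)\<bar>) < e"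
    proof (rule H)
      show "\<forall>i<n. a \<le> - r i \<and> - r i \<le> - l i \<and> - l i \<le> b" using A by force
      show "\<forall>i<n. \<forall>j<n. i \<noteq> j \<longrightarrow> - l i \<le> - r j \<or> - l j \<le> - r i" using A by force
      show "(\<Sum>i<n. - l i - - r i) < d" using A by (simp add: algebra_simps)
    qed
    then show "(\<Sum>i<n. \<bar>f (- r i) - f (- l i)\<bar>) < e"
      by (simp add: abs_minus_commute)
  qed
qed

section \<open>Luzin's property (N)\<close>

lemma is_interval_disjoint_less:
  fixes C D :: "real set"
  assumes iv: "is_interval C" "is_interval D" and dis: "C \<inter> D = {}"
    and cd: "c \<in> C" "d \<in> D" "c < d" and xy: "x \<in> C" "y \<in> D"
  shows "x < y"
proof (rule ccontr)
  assume "\<not> x < y"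
  show False
  proof (cases "y < c")
    case True
    then have "c \<in> D"
      using iv(2) cd xy unfolding is_interval_1 by (meson less_imp_le)
    with cd dis show False by blast
  next
    case False
    then have "y \<in> C"
      using iv(1) cd xy \<open>\<not> x < y\<close> unfolding is_interval_1 by (meson not_le)
    with xy dis show False by blast
  qed
qed

lemma components_closure_ordered:
  fixes C D :: "real set"
  assumes "C \<in> components U" "D \<in> components U" "C \<noteq> D"
  shows "(\<forall>x\<in>closure C. \<forall>y\<in>closure D. x \<le> y) \<or> (\<forall>x\<in>closure D. \<forall>y\<in>closure C. x \<le> y)"
proof -
  have dis: "C \<inter> D = {}"
    using assms pairwise_disjoint_components unfolding pairwise_def by blast
  have iv: "is_interval C" "is_interval D"
    using assms in_components_connected is_interval_connected_1 by blast+
  obtain c d where cd: "c \<in> C" "d \<in> D"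
    using assms in_components_nonempty by blast
  have closure_le: "\<forall>x\<in>closure A. \<forall>y\<in>closure B. x \<le> y" if "\<forall>x\<in>A. \<forall>y\<in>B. x < y" for A B :: "real set"
  proof -
    have "\<forall>y\<in>B. closure A \<subseteq> {..y}"
      using that by (intro ballI closure_minimal) (auto intro: less_imp_le)
    then have "\<forall>x\<in>closure A. closure B \<subseteq> {x..}"
      by (intro ballI closure_minimal) auto
    then show ?thesis by auto
  qed
  have "c < d \<or> d < c"
    using cd dis by (metis disjoint_iff linorder_neqE_linordered_idom)
  then show ?thesis
  proof
    assume "c < d"
    then have "\<forall>x\<in>C. \<forall>y\<in>D. x < y"
      using is_interval_disjoint_less[OF iv dis cd] by blast
    then show ?thesis using closure_le by blast
  next
    assume "d < c"
    then have "\<forall>x\<in>D. \<forall>y\<in>C. x < y"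
      using is_interval_disjoint_less[OF iv(2,1) _ cd(2,1)] dis by blast
    then show ?thesis using closure_le by blast
  qed
qed

lemma is_interval_closure_diff_le_measure:
  fixes C :: "real set"
  assumes C: "is_interval C" "C \<in> lmeasurable" and lr: "l \<in> closure C" "r \<in> closure C"
  shows "r - l \<le> measure lebesgue C"
proof (cases "l \<le> r")
  case True
  have cvx: "convex C" using C(1) by (simp add: is_interval_convex_1)
  then have "{l..r} \<subseteq> closure C"
    using lr True convex_closure closed_segment_subset closed_segment_eq_real_ivl1 by metis
  then have "{l<..<r} \<subseteq> interior C"
    using interior_mono convex_interior_closure[OF cvx] by (metis interior_atLeastAtMost_real)
  then have "measure lebesgue {l<..<r} \<le> measure lebesgue C"
    using C(2) interior_subset by (intro measure_mono_fmeasurable) auto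
  with True show ?thesis by simp
next
  case False
  with measure_nonneg[of lebesgue C] show ?thesis by linarith
qed

lemma measure_image_compact_le:
  fixes f :: "real \<Rightarrow> real"
  assumes K: "compact K" "K \<noteq> {}" and f: "continuous_on K f"
  obtains l r where "l \<in> K" "r \<in> K" "l \<le> r" "measure lebesgue (f ` K) \<le> \<bar>f r - f l\<bar>"
proof -
  obtain s where s: "s \<in> K" "\<forall>y\<in>K. f y \<le> f s" using continuous_attains_sup[OF K f] by blast
  obtain t where t: "t \<in> K" "\<forall>y\<in>K. f t \<le> f y" using continuous_attains_inf[OF K f] by blast
  have "measure lebesgue (f ` K) \<le> measure lebesgue {f t..f s}"
    using s t compact_continuous_image[OF f K(1)]
    by (intro measure_mono_fmeasurable) (auto simp: lmeasurable_compact fmeasurableD)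
  also have "\<dots> = \<bar>f (max s t) - f (min s t)\<bar>"
    using s t by (cases "s \<le> t") (auto simp: max_def min_def)
  finally show thesis
    using s t by (intro that[of "min s t" "max s t"]) (auto simp: min_def max_def)
qed

lemma negligible_outer_open:
  assumes S: "negligible S" and e: "e > 0"
  obtains T where "open T" "S \<subseteq> T" "T \<in> lmeasurable" "measure lebesgue T < e"
proof -
  obtain T where T: "open T" "S \<subseteq> T" "T - S \<in> lmeasurable" "emeasure lebesgue (T - S) < ennreal e"
    using sets_lebesgue_outer_open[OF negligible_imp_sets[OF S] e] by blast
  have TS: "measure lebesgue (T - S) < e"
    using T(3,4) by (simp add: emeasure_eq_measure2 ennreal_less_iff)
  have SL: "S \<in> lmeasurable" "measure lebesgue S = 0"
    using S by (auto simp: negligible_imp_measurable negligible_imp_measure0)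
  have T_eq: "T = (T - S) \<union> S" using T(2) by blast
  have "T \<in> lmeasurable"
    using T(3) SL(1) by (subst T_eq) (rule fmeasurable.Un)
  moreover have "measure lebesgue T \<le> measure lebesgue (T - S) + measure lebesgue S"
    using T(3) SL(1) by (subst T_eq) (intro measure_Un_le; simp add: fmeasurableD)
  ultimately show thesis
    using that T(1,2) TS SL(2) by simp
qed

lemma components_image_measure_le:
  fixes f :: "real \<Rightarrow> real" and U :: "real set"
  assumes U: "open U" "U \<subseteq> {a<..<b}" and f: "continuous_on {a..b} f"
  obtains L R where "\<And>C. C \<in> components U \<Longrightarrow>
      a \<le> L C \<and> L C \<le> R C \<and> R C \<le> b \<and> L C \<in> closure C \<and> R C \<in> closure C \<and>
      f ` closure C \<in> lmeasurable \<and> measure lebesgue (f ` closure C) \<le> \<bar>f (R C) - f (L C)\<bar>"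
proof -
  have "\<exists>l r. a \<le> l \<and> l \<le> r \<and> r \<le> b \<and> l \<in> closure C \<and> r \<in> closure C \<and>
      f ` closure C \<in> lmeasurable \<and> measure lebesgue (f ` closure C) \<le> \<bar>f r - f l\<bar>"
    if C: "C \<in> components U" for C
  proof -
    have "bounded C"
      using in_components_subset[OF C] U(2) bounded_subset[OF bounded_Ioo] by blast
    then have K: "compact (closure C)"
      by (simp add: compact_closure)
    have sub: "closure C \<subseteq> {a..b}"
      using in_components_subset[OF C] U(2) by (intro closure_minimal) auto
    have fK: "continuous_on (closure C) f"
      by (rule continuous_on_subset[OF f sub])
    have "closure C \<noteq> {}"
      using in_components_nonempty[OF C] by simp
    then obtain l r where "l \<in> closure C" "r \<in> closure C" "l \<le> r"
        "measure lebesgue (f ` closure C) \<le> \<bar>f r - f l\<bar>"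
      by (rule measure_image_compact_le[OF K _ fK])
    moreover have "f ` closure C \<in> lmeasurable"
      by (rule lmeasurable_compact[OF compact_continuous_image[OF fK K]])
    ultimately show ?thesis
      using sub by (intro exI[of _ l] exI[of _ r]) auto
  qed
  then have "\<forall>C\<in>components U. \<exists>l r. a \<le> l \<and> l \<le> r \<and> r \<le> b \<and> l \<in> closure C \<and> r \<in> closure C \<and>
      f ` closure C \<in> lmeasurable \<and> measure lebesgue (f ` closure C) \<le> \<bar>f r - f l\<bar>"
    by blast
  from bchoice[OF this] obtain L where "\<forall>C\<in>components U. \<exists>r. a \<le> L C \<and> L C \<le> r \<and> r \<le> b \<and>
      L C \<in> closure C \<and> r \<in> closure C \<and>
      f ` closure C \<in> lmeasurable \<and> measure lebesgue (f ` closure C) \<le> \<bar>f r - f (L C)\<bar>"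
    by blast
  from bchoice[OF this] obtain R where "\<forall>C\<in>components U. a \<le> L C \<and> L C \<le> R C \<and> R C \<le> b \<and>
      L C \<in> closure C \<and> R C \<in> closure C \<and>
      f ` closure C \<in> lmeasurable \<and> measure lebesgue (f ` closure C) \<le> \<bar>f (R C) - f (L C)\<bar>"
    by blast
  with that show thesis by blast
qed

lemma sum_components_span_le_measure:
  fixes U :: "real set"
  assumes U: "open U" "U \<in> lmeasurable" and I: "I \<subseteq> components U" "finite I"
    and LR: "\<And>C. C \<in> I \<Longrightarrow> L C \<in> closure C \<and> R C \<in> closure C"
  shows "(\<Sum>C\<in>I. R C - L C) \<le> measure lebesgue U"
proof -
  have C: "is_interval C" "C \<subseteq> U" "C \<in> lmeasurable" if "C \<in> I" for C
  proof -
    have C: "C \<in> components U" using that I(1) by blast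
    show "is_interval C"
      using in_components_connected[OF C] is_interval_connected_1 by blast
    show "C \<subseteq> U"
      by (rule in_components_subset[OF C])
    moreover have "C \<in> sets lebesgue"
      using open_components[OF U(1) C] by (simp add: lebesgue_openin)
    ultimately show "C \<in> lmeasurable"
      using U(2) fmeasurableI2 by blast
  qed
  have "(\<Sum>C\<in>I. R C - L C) \<le> (\<Sum>C\<in>I. measure lebesgue C)"
    using LR C(1,3) by (intro sum_mono is_interval_closure_diff_le_measure) auto
  also have "\<dots> = measure lebesgue (\<Union>I)"
    using I C(3) pairwise_subset[OF pairwise_disjoint_components[of U] I(1)]
    by (intro measure_Union'[symmetric]) (auto simp: disjnt_def pairwise_def)
  also have "\<dots> \<le> measure lebesgue U"
  proof (rule measure_mono_fmeasurable)
    show "\<Union>I \<in> sets lebesgue"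
      using I C(3) by (intro sets.finite_Union) (auto simp: fmeasurableD)
  qed (use C(2) U(2) in auto)
  finally show ?thesis .
qed

lemma abs_continuous_on_components_sum_less:
  fixes f :: "real \<Rightarrow> real"
  assumes ac: "abs_continuous_on f a b" and e: "e > 0"
  obtains d where "d > 0"
    "\<And>U I L R. open U \<Longrightarrow> U \<subseteq> {a<..<b} \<Longrightarrow> measure lebesgue U < d \<Longrightarrow>
       I \<subseteq> components U \<Longrightarrow> finite I \<Longrightarrow>
       (\<And>C. C \<in> I \<Longrightarrow> a \<le> L C \<and> L C \<le> R C \<and> R C \<le> b \<and> L C \<in> closure C \<and> R C \<in> closure C) \<Longrightarrow>
       (\<Sum>C\<in>I. \<bar>f (R C) - f (L C)\<bar>) < e"
proof -
  obtain d where d: "d > 0" and H: "\<And>(I::real set set) l r. finite I \<Longrightarrow>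
      (\<forall>i\<in>I. a \<le> l i \<and> l i \<le> r i \<and> r i \<le> b) \<Longrightarrow>
      (\<forall>i\<in>I. \<forall>j\<in>I. i \<noteq> j \<longrightarrow> r i \<le> l j \<or> r j \<le> l i) \<Longrightarrow>
      (\<Sum>i\<in>I. r i - l i) < d \<Longrightarrow> (\<Sum>i\<in>I. \<bar>f (r i) - f (l i)\<bar>) < e"
    by (rule abs_continuous_onE_finite[OF ac e]) blast
  have "(\<Sum>C\<in>I. \<bar>f (R C) - f (L C)\<bar>) < e"
    if U: "open U" "U \<subseteq> {a<..<b}" "measure lebesgue U < d" and I: "I \<subseteq> components U" "finite I"
      and LR: "\<And>C. C \<in> I \<Longrightarrow> a \<le> L C \<and> L C \<le> R C \<and> R C \<le> b \<and> L C \<in> closure C \<and> R C \<in> closure C"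
    for U I L R
  proof (rule H[OF I(2)])
    show "\<forall>C\<in>I. a \<le> L C \<and> L C \<le> R C \<and> R C \<le> b"
      using LR by blast
    show "\<forall>C\<in>I. \<forall>D\<in>I. C \<noteq> D \<longrightarrow> R C \<le> L D \<or> R D \<le> L C"
    proof (intro ballI impI)
      fix C D assume "C \<in> I" "D \<in> I" "C \<noteq> D"
      with components_closure_ordered[of C U D] I(1) LR[of C] LR[of D]
      show "R C \<le> L D \<or> R D \<le> L C" by blast
    qed
    have "U \<in> lmeasurable"
      using U(1,2) bounded_subset[OF bounded_Ioo] lmeasurable_open by blast
    then have "(\<Sum>C\<in>I. R C - L C) \<le> measure lebesgue U"
      using I LR by (intro sum_components_span_le_measure[OF U(1)]) auto
    with U(3) show "(\<Sum>C\<in>I. R C - L C) < d" by linarith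
  qed
  with d show thesis by (rule that)
qed

lemma abs_continuous_on_image_open_small:
  fixes f :: "real \<Rightarrow> real"
  assumes ac: "abs_continuous_on f a b" and e: "e > 0"
  obtains d where "d > 0"
    "\<And>U. open U \<Longrightarrow> U \<subseteq> {a<..<b} \<Longrightarrow> measure lebesgue U < d \<Longrightarrow>
       \<exists>T. f ` U \<subseteq> T \<and> T \<in> lmeasurable \<and> measure lebesgue T \<le> e"
proof -
  obtain d where d: "d > 0" and sum_less: "\<And>U I L R. open U \<Longrightarrow> U \<subseteq> {a<..<b} \<Longrightarrow> measure lebesgue U < d \<Longrightarrow>
       I \<subseteq> components U \<Longrightarrow> finite I \<Longrightarrow>
       (\<And>C. C \<in> I \<Longrightarrow> a \<le> L C \<and> L C \<le> R C \<and> R C \<le> b \<and> L C \<in> closure C \<and> R C \<in> closure C) \<Longrightarrow>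
       (\<Sum>C\<in>I. \<bar>f (R C) - f (L C)\<bar>) < e"
    by (rule abs_continuous_on_components_sum_less[OF ac e]) blast
  have "\<exists>T. f ` U \<subseteq> T \<and> T \<in> lmeasurable \<and> measure lebesgue T \<le> e"
    if U: "open U" "U \<subseteq> {a<..<b}" "measure lebesgue U < d" for U
  proof -
    obtain L R where LR: "\<And>C. C \<in> components U \<Longrightarrow>
        a \<le> L C \<and> L C \<le> R C \<and> R C \<le> b \<and> L C \<in> closure C \<and> R C \<in> closure C \<and>
        f ` closure C \<in> lmeasurable \<and> measure lebesgue (f ` closure C) \<le> \<bar>f (R C) - f (L C)\<bar>"
      using components_image_measure_le[OF U(1,2) abs_continuous_on_imp_continuous_on[OF ac]] by blast
    have bound: "measure lebesgue (\<Union>C\<in>I. f ` closure C) \<le> e" if I: "I \<subseteq> components U" "finite I" for I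
    proof -
      have "measure lebesgue (\<Union>C\<in>I. f ` closure C) \<le> (\<Sum>C\<in>I. measure lebesgue (f ` closure C))"
        using I LR by (intro measure_UNION_le) (auto simp: fmeasurableD)
      also have "\<dots> \<le> (\<Sum>C\<in>I. \<bar>f (R C) - f (L C)\<bar>)"
        using I LR by (intro sum_mono) auto
      also have "\<dots> < e"
        using I LR by (intro sum_less[OF U]) auto
      finally show ?thesis by linarith
    qed
    have countable: "countable (components U)"
      using open_components[OF U(1)] pairwise_disjoint_components[of U]
      by (intro countable_disjoint_open_subsets) (auto simp: pairwise_def disjnt_def)
    have "f ` U \<subseteq> (\<Union>C\<in>components U. f ` closure C)"
      using Union_components[of U] closure_subset by blast
    moreover have "(\<Union>C\<in>components U. f ` closure C) \<in> lmeasurable"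
      using LR by (intro fmeasurable_UN_bound[OF countable _ bound]) auto
    moreover have "measure lebesgue (\<Union>C\<in>components U. f ` closure C) \<le> e"
      using LR by (intro measure_UN_bound[OF countable _ bound]) auto
    ultimately show ?thesis by blast
  qed
  with d show thesis by (rule that)
qed

lemma abs_continuous_on_negligible_image:
  fixes f :: "real \<Rightarrow> real"
  assumes ac: "abs_continuous_on f a b" and N: "negligible N" "N \<subseteq> {a..b}"
  shows "negligible (f ` N)"
proof -
  have "negligible (f ` (N \<inter> {a<..<b}))"
    unfolding negligible_outer_le
  proof (intro allI impI)
    fix e :: real assume "e > 0"
    obtain d where d: "d > 0" and small: "\<And>U. open U \<Longrightarrow> U \<subseteq> {a<..<b} \<Longrightarrow> measure lebesgue U < d \<Longrightarrow>
        \<exists>T. f ` U \<subseteq> T \<and> T \<in> lmeasurable \<and> measure lebesgue T \<le> e"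
      by (rule abs_continuous_on_image_open_small[OF ac \<open>e > 0\<close>]) blast
    have "negligible (N \<inter> {a<..<b})"
      using N(1) by (simp add: negligible_Int)
    then obtain V where V: "open V" "N \<inter> {a<..<b} \<subseteq> V" "V \<in> lmeasurable" "measure lebesgue V < d"
      by (rule negligible_outer_open[OF _ d])
    have "measure lebesgue (V \<inter> {a<..<b}) \<le> measure lebesgue V"
      using V(3) by (intro measure_mono_fmeasurable) auto
    with V(4) have "measure lebesgue (V \<inter> {a<..<b}) < d"
      by linarith
    moreover have "open (V \<inter> {a<..<b})"
      using V(1) by (simp add: open_Int)
    ultimately obtain T where "f ` (V \<inter> {a<..<b}) \<subseteq> T" "T \<in> lmeasurable" "measure lebesgue T \<le> e"
      using small[of "V \<inter> {a<..<b}"] by blast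
    then show "\<exists>T. f ` (N \<inter> {a<..<b}) \<subseteq> T \<and> T \<in> lmeasurable \<and> measure lebesgue T \<le> e"
      using V(2) by blast
  qed
  moreover have "N \<subseteq> (N \<inter> {a<..<b}) \<union> {a, b}"
    using N(2) by auto
  from image_mono[OF this, of f] have "f ` N \<subseteq> f ` (N \<inter> {a<..<b}) \<union> {f a, f b}"
    by simp
  ultimately show ?thesis
    using negligible_subset[of "f ` (N \<inter> {a<..<b}) \<union> {f a, f b}" "f ` N"] by simp
qed

section \<open>The fundamental theorem of calculus for absolutely continuous functions\<close>

lemma lmeasurable_vec_image:
  fixes A :: "real set"
  assumes "(vec ` A :: (real^1) set) \<in> lmeasurable"
  shows "A \<in> lmeasurable \<and> measure lebesgue A = measure lebesgue (vec ` A :: (real^1) set)"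
proof -
  have i: "(\<lambda>x::real^1. 1::real) integrable_on vec ` A"
    using lmeasurable_iff_integrable_on[THEN iffD1, OF assms] .
  have e: "measure lebesgue (vec ` A :: (real^1) set) = integral (vec ` A) (\<lambda>x::real^1. 1::real)"
    by (rule lmeasure_integral[OF assms])
  have "((\<lambda>x::real^1. 1::real) has_integral measure lebesgue (vec ` A :: (real^1) set)) (vec ` A)"
    unfolding e using i by (rule integrable_integral)
  from has_integral_vec1_I[OF this]
  have "((\<lambda>x::real. 1::real) has_integral measure lebesgue (vec ` A :: (real^1) set)) A"
    by (simp add: o_def image_image)
  then have A: "A \<in> lmeasurable"
    using lmeasurable_iff_integrable_on[THEN iffD2, OF has_integral_integrable] by blast
  have "measure lebesgue A = integral A (\<lambda>x. 1)" by (rule lmeasure_integral[OF A])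
  also have "\<dots> = measure lebesgue (vec ` A :: (real^1) set)"
    using \<open>((\<lambda>x::real. 1::real) has_integral _) A\<close> by (rule integral_unique)
  finally show ?thesis using A by simp
qed

text \<open>The area formula of the library is stated for \<open>real^'n\<close>; it is transferred along
  \<open>vec :: real \<Rightarrow> real^1\<close>.\<close>

lemma measure_differentiable_image_real:
  fixes g g' :: "real \<Rightarrow> real"
  assumes S: "S \<in> sets lebesgue"
    and der: "\<And>x. x \<in> S \<Longrightarrow> (g has_real_derivative g' x) (at x within S)"
    and int: "(\<lambda>x. \<bar>g' x\<bar>) integrable_on S"
  shows "g ` S \<in> lmeasurable \<and> measure lebesgue (g ` S) \<le> integral S (\<lambda>x. \<bar>g' x\<bar>)"
proof -
  let ?lift = "vec :: real \<Rightarrow> real^1"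
  let ?drop = "(\<lambda>x::real^1. x $ 1)"
  have S': "?lift ` S \<in> sets lebesgue"
    by (auto intro: differentiable_image_in_sets_lebesgue [OF S] differentiable_vec)
  have "((\<lambda>x. vec (g (x $ 1))) has_derivative (*\<^sub>R) (g' z)) (at (vec z) within ?lift ` S)"
    if "z \<in> S" for z
    using der [OF that]
    by (simp add: has_real_derivative_iff_has_vector_derivative has_vector_derivative_def has_derivative_vector_1)
  then have der': "\<And>x. x \<in> ?lift ` S \<Longrightarrow>
        (?lift \<circ> g \<circ> ?drop has_derivative (*\<^sub>R) (g' (?drop x))) (at x within ?lift ` S)"
    by (auto simp: o_def)
  have "((\<lambda>x::real^1. \<bar>g' (x$1)\<bar>) \<circ> vec has_integral integral S (\<lambda>x. \<bar>g' x\<bar>)) ((\<lambda>x. x $ 1) ` ?lift ` S)"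
    using int by (simp add: o_def image_image integrable_integral)
  from has_integral_vec1_D[OF this]
  have int': "((\<lambda>x::real^1. \<bar>g' (x$1)\<bar>) has_integral integral S (\<lambda>x. \<bar>g' x\<bar>)) (?lift ` S)" .
  have int'': "(\<lambda>x. \<bar>det (matrix ((*\<^sub>R) (g' (?drop x)) :: real^1 \<Rightarrow> real^1))\<bar>) integrable_on ?lift ` S"
    using int' by (simp add: det_matrix_scaleR integrable_on_def) blast
  have m: "?lift ` g ` S \<in> lmeasurable"
    using measurable_differentiable_image[OF S' der' int''] by (simp add: image_image o_def)
  have "measure lebesgue (?lift ` g ` S) \<le> integral (?lift ` S) (\<lambda>x. \<bar>det (matrix ((*\<^sub>R) (g' (?drop x)) :: real^1 \<Rightarrow> real^1))\<bar>)"
    using measure_differentiable_image[OF S' der' int''] by (simp add: image_image o_def)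
  also have "\<dots> = integral S (\<lambda>x. \<bar>g' x\<bar>)"
    using int' by (simp add: det_matrix_scaleR integral_unique)
  finally show ?thesis using lmeasurable_vec_image[OF m] by simp
qed

text \<open>The interval between \<open>f a\<close> and \<open>f b\<close> lies in \<open>f ` {a..b}\<close>, which is covered by the image of
  the points of differentiability, bounded by the area formula, and the image of a null set, which is
  null by Luzin's property.\<close>

lemma abs_continuous_on_diff_le_integral:
  fixes f f' :: "real \<Rightarrow> real"
  assumes ac: "abs_continuous_on f a b" and ab: "a \<le> b" and N: "negligible N"
    and der: "\<And>x. x \<in> {a..b} - N \<Longrightarrow> (f has_real_derivative f' x) (at x)"
    and int: "(\<lambda>x. \<bar>f' x\<bar>) integrable_on {a..b}"
  shows "\<bar>f b - f a\<bar> \<le> integral {a..b} (\<lambda>x. \<bar>f' x\<bar>)"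
proof -
  define S where "S = {a..b} - N"
  have S: "S \<in> sets lebesgue"
    unfolding S_def using N by (intro sets.Diff) (auto simp: negligible_imp_sets)
  have negS: "negligible {x \<in> S - {a..b}. \<bar>f' x\<bar> \<noteq> 0}" "negligible {x \<in> {a..b} - S. \<bar>f' x\<bar> \<noteq> 0}"
    by (auto simp: S_def intro: negligible_subset[OF N])
  have intS: "(\<lambda>x. \<bar>f' x\<bar>) integrable_on S"
    by (rule integrable_spike_set[OF int]) (use negS in \<open>auto simp: S_def\<close>)
  have eqS: "integral S (\<lambda>x. \<bar>f' x\<bar>) = integral {a..b} (\<lambda>x. \<bar>f' x\<bar>)"
    by (rule integral_spike_set) (use negS in auto)
  have derS: "(f has_real_derivative f' x) (at x within S)" if "x \<in> S" for x
    using der[of x] that by (auto simp: S_def intro: has_field_derivative_at_within)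
  have fS: "f ` S \<in> lmeasurable" "measure lebesgue (f ` S) \<le> integral {a..b} (\<lambda>x. \<bar>f' x\<bar>)"
    using measure_differentiable_image_real[OF S derS intS] eqS by auto
  have fN: "negligible (f ` (N \<inter> {a..b}))"
    using N by (intro abs_continuous_on_negligible_image[OF ac]) (auto simp: negligible_Int)
  have "is_interval (f ` {a..b})"
    using connected_continuous_image[OF abs_continuous_on_imp_continuous_on[OF ac]]
    by (simp add: is_interval_connected_1)
  moreover have "min (f a) (f b) \<in> f ` {a..b}" "max (f a) (f b) \<in> f ` {a..b}"
    using ab by (auto simp: min_def max_def)
  ultimately have "{min (f a) (f b)..max (f a) (f b)} \<subseteq> f ` {a..b}"
    unfolding is_interval_1 by auto
  then have sub: "{min (f a) (f b)..max (f a) (f b)} \<subseteq> f ` S \<union> f ` (N \<inter> {a..b})"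
    by (auto simp: S_def)
  have "\<bar>f b - f a\<bar> = measure lebesgue {min (f a) (f b)..max (f a) (f b)}"
    by (simp add: abs_real_def max_def min_def)
  also have "\<dots> \<le> measure lebesgue (f ` S \<union> f ` (N \<inter> {a..b}))"
    using sub fS fN by (intro measure_mono_fmeasurable) (auto simp: negligible_imp_measurable)
  also have "\<dots> \<le> measure lebesgue (f ` S) + measure lebesgue (f ` (N \<inter> {a..b}))"
    using fS fN by (intro measure_Un_le) (auto simp: negligible_imp_sets)
  also have "\<dots> \<le> integral {a..b} (\<lambda>x. \<bar>f' x\<bar>)"
    using fS fN by (simp add: negligible_imp_measure0)
  finally show ?thesis .
qed

lemma abs_continuous_on_diff_le_nn_integral:
  fixes f f' :: "real \<Rightarrow> real"
  assumes ac: "abs_continuous_on f a b" and ab: "a \<le> b" and N: "negligible N"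
    and der: "\<And>x. x \<in> {a..b} - N \<Longrightarrow> (f has_real_derivative f' x) (at x)"
    and meas: "set_borel_measurable borel {a..b} f'"
  shows "ennreal \<bar>f b - f a\<bar> \<le> (\<integral>\<^sup>+x\<in>{a..b}. ennreal \<bar>f' x\<bar> \<partial>lborel)"
proof (cases "(\<integral>\<^sup>+x\<in>{a..b}. ennreal \<bar>f' x\<bar> \<partial>lborel) = \<infinity>")
  case False
  define g where "g x = indicator {a..b} x * \<bar>f' x\<bar>" for x
  have g_eq: "g = (\<lambda>x. \<bar>indicator {a..b} x *\<^sub>R f' x\<bar>)"
    by (auto simp: g_def indicator_def fun_eq_iff)
  have gm: "g \<in> borel_measurable borel"
    using meas unfolding g_eq set_borel_measurable_def by measurable
  have g_nn: "(\<integral>\<^sup>+x\<in>{a..b}. ennreal \<bar>f' x\<bar> \<partial>lborel) = (\<integral>\<^sup>+x. g x \<partial>lborel)"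
    by (intro nn_integral_cong) (auto simp: g_def indicator_def)
  have gfin: "(\<integral>\<^sup>+x. g x \<partial>lborel) < \<infinity>"
    using False g_nn by (simp add: top.not_eq_extremum)
  have g_if: "g = (\<lambda>x. if x \<in> {a..b} then \<bar>f' x\<bar> else 0)"
    by (auto simp: g_def indicator_def fun_eq_iff)
  have "g integrable_on UNIV"
    by (rule nn_integral_integrable_on[OF gm _ gfin]) (simp add: g_def)
  then have int: "(\<lambda>x. \<bar>f' x\<bar>) integrable_on {a..b}"
    unfolding g_if integrable_restrict_UNIV .
  have "(\<integral>\<^sup>+x. g x \<partial>lborel) = integral UNIV g"
    by (rule nn_integral_lborel_eq_integral[OF gm _ gfin]) (simp add: g_def)
  also have "\<dots> = integral {a..b} (\<lambda>x. \<bar>f' x\<bar>)"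
    unfolding g_if integral_restrict_UNIV ..
  finally show ?thesis
    using abs_continuous_on_diff_le_integral[OF ac ab N der int] g_nn by (simp add: ennreal_leI)
qed simp

section \<open>Weighted integral estimates\<close>

lemma has_real_derivative_powr_diff:
  assumes "x < x0"
  shows "((\<lambda>t. (x0 - t) powr c) has_real_derivative - c * (x0 - x) powr (c - 1)) (at x)"
proof -
  have "((\<lambda>t. x0 - t) has_real_derivative -1) (at x)"
    by (auto intro!: derivative_eq_intros)
  from DERIV_fun_powr[OF this, of c] assms show ?thesis by simp
qed

lemma nn_integral_powr_diff_Ico:
  fixes x0 t e :: real
  assumes e: "e > -1" and t: "t \<le> x0"
  shows "(\<integral>\<^sup>+x\<in>{t..<x0}. ennreal ((x0 - x) powr e) \<partial>lborel) = ennreal ((x0 - t) powr (e + 1) / (e + 1))"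
proof -
  define F where "F x = - ((x0 - x) powr (e + 1)) / (e + 1)" for x
  have "((\<lambda>x. (x0 - x) powr e) has_integral (F x0 - F t)) {t..x0}"
  proof (rule fundamental_theorem_of_calculus_interior[OF t])
    show "continuous_on {t..x0} F"
      unfolding F_def using e by (intro continuous_intros continuous_on_powr') auto
    fix x assume x: "x \<in> {t<..<x0}"
    have "(F has_real_derivative - (- (e + 1) * (x0 - x) powr (e + 1 - 1)) / (e + 1)) (at x)"
      unfolding F_def using x by (intro DERIV_cdivide DERIV_minus has_real_derivative_powr_diff) auto
    moreover have "- (- (e + 1) * (x0 - x) powr (e + 1 - 1)) / (e + 1) = (x0 - x) powr e"
      using e by (simp add: field_simps)
    ultimately show "(F has_vector_derivative (x0 - x) powr e) (at x)"
      by (simp add: has_real_derivative_iff_has_vector_derivative)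
  qed
  then have "(\<integral>\<^sup>+x\<in>{t..x0}. ennreal ((x0 - x) powr e) \<partial>lborel) = ennreal ((x0 - t) powr (e + 1) / (e + 1))"
    by (subst nn_integral_has_integral_lebesgue') (auto simp: F_def)
  moreover have "(\<integral>\<^sup>+x\<in>{t..<x0}. ennreal ((x0 - x) powr e) \<partial>lborel)
      = (\<integral>\<^sup>+x\<in>{t..x0}. ennreal ((x0 - x) powr e) \<partial>lborel)"
    using AE_lborel_singleton[of x0] by (intro nn_integral_cong_AE) (auto elim!: eventually_mono simp: indicator_def)
  ultimately show ?thesis by simp
qed

lemma nn_integral_powr_diff_le:
  fixes x0 s x a :: real
  assumes a: "a > 1" and sx: "s \<le> x" "x < x0"
  shows "(\<integral>\<^sup>+t\<in>{s..x}. ennreal ((x0 - t) powr - a) \<partial>lborel) \<le> ennreal ((x0 - x) powr (1 - a) / (a - 1))"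
proof -
  define F where "F t = (x0 - t) powr (1 - a) / (a - 1)" for t
  have "((\<lambda>t. (x0 - t) powr - a) has_integral (F x - F s)) {s..x}"
  proof (rule fundamental_theorem_of_calculus[OF sx(1)])
    fix y assume "y \<in> {s..x}"
    then have "(F has_real_derivative - (1 - a) * (x0 - y) powr (1 - a - 1) / (a - 1)) (at y)"
      unfolding F_def using sx by (intro DERIV_cdivide has_real_derivative_powr_diff) auto
    then show "(F has_vector_derivative (x0 - y) powr - a) (at y within {s..x})"
      using a by (simp add: has_real_derivative_iff_has_vector_derivative has_vector_derivative_at_within)
  qed
  then have "(\<integral>\<^sup>+t\<in>{s..x}. ennreal ((x0 - t) powr - a) \<partial>lborel) = ennreal (F x - F s)"
    by (subst nn_integral_has_integral_lebesgue') auto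
  also have "\<dots> \<le> ennreal (F x)"
    using a by (intro ennreal_leI) (simp add: F_def)
  finally show ?thesis by (simp add: F_def)
qed

lemma set_borel_measurable_continuous_on:
  fixes f :: "real \<Rightarrow> real"
  assumes "continuous_on S f" "S \<in> sets borel"
  shows "set_borel_measurable borel S f"
  unfolding set_borel_measurable_def by (rule borel_measurable_continuous_on_indicator[OF assms(2,1)])

lemma set_borel_measurable_mult_square:
  fixes p h :: "real \<Rightarrow> real"
  assumes "set_borel_measurable borel S p" "set_borel_measurable borel S h"
  shows "set_borel_measurable borel S (\<lambda>x. p x * (h x)\<^sup>2)"
proof -
  have "(\<lambda>x. (indicator S x *\<^sub>R p x) * (indicator S x *\<^sub>R h x)\<^sup>2) \<in> borel_measurable borel"
    using assms unfolding set_borel_measurable_def by measurable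
  then show ?thesis
    unfolding set_borel_measurable_def
    by (rule measurable_cong[THEN iffD1, rotated]) (simp add: indicator_def)
qed

lemma borel_measurable_ennreal_indicator:
  fixes g :: "real \<Rightarrow> real"
  assumes "set_borel_measurable borel S g"
  shows "(\<lambda>x. ennreal (g x) * indicator S x) \<in> borel_measurable borel"
proof -
  have "(\<lambda>x. ennreal (indicator S x *\<^sub>R g x)) \<in> borel_measurable borel"
    using assms unfolding set_borel_measurable_def by measurable
  then show ?thesis
    by (rule measurable_cong[THEN iffD1, rotated]) (simp add: indicator_def)
qed

lemma set_nn_integral_mult_le:
  fixes h r :: "real \<Rightarrow> real"
  assumes h: "set_borel_measurable borel S h" "\<And>t. t \<in> S \<Longrightarrow> 0 \<le> h t"
    and c: "0 \<le> c" "\<And>t. t \<in> S \<Longrightarrow> c \<le> r t"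
  shows "ennreal c * (\<integral>\<^sup>+t\<in>S. ennreal (h t) \<partial>lborel) \<le> (\<integral>\<^sup>+t\<in>S. ennreal (r t * h t) \<partial>lborel)"
proof -
  have "ennreal c * (\<integral>\<^sup>+t\<in>S. ennreal (h t) \<partial>lborel) = (\<integral>\<^sup>+t. ennreal c * (ennreal (h t) * indicator S t) \<partial>lborel)"
    using borel_measurable_ennreal_indicator[OF h(1)] by (intro nn_integral_cmult[symmetric]) simp
  also have "\<dots> \<le> (\<integral>\<^sup>+t\<in>S. ennreal (r t * h t) \<partial>lborel)"
    using h(2) c
    by (intro nn_integral_mono) (auto simp: indicator_def ennreal_mult'[symmetric] intro!: ennreal_leI mult_right_mono)
  finally show ?thesis .
qed

lemma nn_integral_Cauchy_Schwarz_weighted: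
  fixes g h :: "real \<Rightarrow> real"
  assumes [measurable]: "g \<in> borel_measurable borel" "h \<in> borel_measurable borel" "S \<in> sets borel"
    and g: "\<And>x. x \<in> S \<Longrightarrow> g x > 0"
  shows "(\<integral>\<^sup>+x\<in>S. ennreal \<bar>h x\<bar> \<partial>lborel)\<^sup>2
    \<le> (\<integral>\<^sup>+x\<in>S. ennreal (1 / g x) \<partial>lborel) * (\<integral>\<^sup>+x\<in>S. ennreal (g x * (h x)\<^sup>2) \<partial>lborel)"
proof -
  define F where "F x = ennreal (sqrt (1 / g x)) * indicator S x" for x
  define G where "G x = ennreal (sqrt (g x) * \<bar>h x\<bar>) * indicator S x" for x
  have "F x * G x = ennreal \<bar>h x\<bar> * indicator S x" for x
    using g[of x] by (cases "x \<in> S") (auto simp: F_def G_def ennreal_mult'[symmetric] real_sqrt_mult[symmetric])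
  moreover have "F x ^ 2 = ennreal (1 / g x) * indicator S x" for x
    using g[of x] by (cases "x \<in> S") (auto simp: F_def ennreal_power)
  moreover have "G x ^ 2 = ennreal (g x * (h x)\<^sup>2) * indicator S x" for x
    using g[of x] by (cases "x \<in> S") (auto simp: G_def ennreal_power power_mult_distrib)
  moreover have "F \<in> borel_measurable lborel" "G \<in> borel_measurable lborel"
    unfolding F_def G_def by measurable
  ultimately show ?thesis
    using Cauchy_Schwarz_nn_integral[of F lborel G] by simp
qed

section \<open>The one-sided Hardy inequality\<close>

lemma square_le_weighted_nn_integral:
  fixes w w' :: "real \<Rightarrow> real"
  assumes a: "a > 1" and sx: "s \<le> x" "x < x0"
    and ac: "abs_continuous_on w s x" and N: "negligible N"
    and der: "\<And>t. t \<in> {s..x} - N \<Longrightarrow> (w has_real_derivative w' t) (at t)"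
    and meas: "set_borel_measurable borel {s..x} w'"
  shows "ennreal ((w x)\<^sup>2) \<le> ennreal (2 * (w s)\<^sup>2)
    + ennreal (2 * (x0 - x) powr (1 - a) / (a - 1)) * (\<integral>\<^sup>+t\<in>{s..x}. ennreal ((x0 - t) powr a * (w' t)\<^sup>2) \<partial>lborel)"
proof -
  define W where "W t = indicator {s..x} t * w' t" for t
  have [measurable]: "W \<in> borel_measurable borel"
    using meas unfolding set_borel_measurable_def W_def by simp
  define J where "J = (\<integral>\<^sup>+t\<in>{s..x}. ennreal ((x0 - t) powr a * (w' t)\<^sup>2) \<partial>lborel)"
  define V where "V = (\<integral>\<^sup>+t\<in>{s..x}. ennreal \<bar>w' t\<bar> \<partial>lborel)"
  have cong: "(\<integral>\<^sup>+t\<in>{s..x}. ennreal \<bar>W t\<bar> \<partial>lborel) = V"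
    "(\<integral>\<^sup>+t\<in>{s..x}. ennreal ((x0 - t) powr a * (W t)\<^sup>2) \<partial>lborel) = J"
    unfolding V_def J_def by (auto intro!: set_nn_integral_cong simp: W_def)
  have "V\<^sup>2 \<le> (\<integral>\<^sup>+t\<in>{s..x}. ennreal (1 / (x0 - t) powr a) \<partial>lborel) * J"
    using nn_integral_Cauchy_Schwarz_weighted[of "\<lambda>t. (x0 - t) powr a" W "{s..x}"] sx
    unfolding cong by auto
  also have "(\<integral>\<^sup>+t\<in>{s..x}. ennreal (1 / (x0 - t) powr a) \<partial>lborel) \<le> ennreal ((x0 - x) powr (1 - a) / (a - 1))"
    using nn_integral_powr_diff_le[OF a sx] by (simp add: powr_minus_divide)
  finally have V2: "V\<^sup>2 \<le> ennreal ((x0 - x) powr (1 - a) / (a - 1)) * J"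
    by (simp add: mult_right_mono)
  have "ennreal \<bar>w x - w s\<bar> \<le> V"
    unfolding V_def using ac sx(1) N der meas by (rule abs_continuous_on_diff_le_nn_integral)
  have "(w x)\<^sup>2 \<le> 2 * (w s)\<^sup>2 + 2 * \<bar>w x - w s\<bar>\<^sup>2"
    using sum_squares_ge_zero[of "w x - 2 * w s" 0] by (simp add: power2_eq_square algebra_simps)
  then have "ennreal ((w x)\<^sup>2) \<le> ennreal (2 * (w s)\<^sup>2 + 2 * \<bar>w x - w s\<bar>\<^sup>2)"
    by (rule ennreal_leI)
  also have "\<dots> = ennreal (2 * (w s)\<^sup>2) + 2 * (ennreal \<bar>w x - w s\<bar>)\<^sup>2"
    by (subst ennreal_plus) (auto simp: ennreal_mult ennreal_power)
  also have "\<dots> \<le> ennreal (2 * (w s)\<^sup>2) + 2 * V\<^sup>2"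
    using \<open>ennreal \<bar>w x - w s\<bar> \<le> V\<close> by (intro add_left_mono mult_left_mono power_mono) auto
  also have "\<dots> \<le> ennreal (2 * (w s)\<^sup>2) + 2 * (ennreal ((x0 - x) powr (1 - a) / (a - 1)) * J)"
    using V2 by (intro add_left_mono mult_left_mono) auto
  also have "\<dots> = ennreal (2 * (w s)\<^sup>2) + ennreal (2 * (x0 - x) powr (1 - a) / (a - 1)) * J"
    using ennreal_mult'[of 2 "(x0 - x) powr (1 - a) / (a - 1)"] by (simp add: mult.assoc)
  finally show ?thesis unfolding J_def .
qed

lemma nn_integral_triangle_swap:
  fixes f k :: "real \<Rightarrow> ennreal"
  assumes [measurable]: "f \<in> borel_measurable borel" "k \<in> borel_measurable borel"
  shows "(\<integral>\<^sup>+x\<in>{s..<b}. k x * (\<integral>\<^sup>+t\<in>{s..x}. f t \<partial>lborel) \<partial>lborel)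
       = (\<integral>\<^sup>+t\<in>{s..<b}. f t * (\<integral>\<^sup>+x\<in>{t..<b}. k x \<partial>lborel) \<partial>lborel)"
proof -
  define H where "H x t = (if s \<le> t \<and> t \<le> x \<and> x < b then k x * f t else 0)" for x t
  have [measurable]: "(\<lambda>(x, t). H x t) \<in> borel_measurable (lborel \<Otimes>\<^sub>M lborel)"
    unfolding H_def by measurable
  have "k x * (\<integral>\<^sup>+t\<in>{s..x}. f t \<partial>lborel) * indicator {s..<b} x = (\<integral>\<^sup>+t. H x t \<partial>lborel)" for x
  proof -
    have "k x * (\<integral>\<^sup>+t\<in>{s..x}. f t \<partial>lborel) * indicator {s..<b} x
        = (\<integral>\<^sup>+t. k x * indicator {s..<b} x * (f t * indicator {s..x} t) \<partial>lborel)"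
      by (subst nn_integral_cmult) (auto simp: mult_ac)
    also have "\<dots> = (\<integral>\<^sup>+t. H x t \<partial>lborel)"
      by (intro nn_integral_cong) (auto simp: H_def indicator_def)
    finally show ?thesis .
  qed
  moreover have "f t * (\<integral>\<^sup>+x\<in>{t..<b}. k x \<partial>lborel) * indicator {s..<b} t = (\<integral>\<^sup>+x. H x t \<partial>lborel)" for t
  proof -
    have "f t * (\<integral>\<^sup>+x\<in>{t..<b}. k x \<partial>lborel) * indicator {s..<b} t
        = (\<integral>\<^sup>+x. f t * indicator {s..<b} t * (k x * indicator {t..<b} x) \<partial>lborel)"
      by (subst nn_integral_cmult) (auto simp: mult_ac)
    also have "\<dots> = (\<integral>\<^sup>+x. H x t \<partial>lborel)"
      by (intro nn_integral_cong) (auto simp: H_def indicator_def mult.commute)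
    finally show ?thesis .
  qed
  ultimately show ?thesis
    using lborel_pair.Fubini'[of H] by simp
qed

lemma hardy_integrand_le:
  fixes p w w' :: "real \<Rightarrow> real"
  assumes a: "a > 1" and sx: "s \<le> x" "x < x0"
    and p_nonneg: "\<And>y. y \<in> {s..x} \<Longrightarrow> 0 \<le> p y"
    and p_mono: "antimono_on {s..x} (\<lambda>y. p y / (x0 - y) powr q)"
    and ac: "abs_continuous_on w s x" and N: "negligible N"
    and der: "\<And>t. t \<in> {s..x} - N \<Longrightarrow> (w has_real_derivative w' t) (at t)"
    and meas: "set_borel_measurable borel {s..x} w'"
  shows "ennreal (p x / (x - x0)\<^sup>2 * (w x)\<^sup>2)
    \<le> ennreal (2 * (w s)\<^sup>2 * (p s / (x0 - s) powr q) * (x0 - x) powr (q - 2))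
      + ennreal (2 / (a - 1) * (x0 - x) powr (q - 1 - a))
        * (\<integral>\<^sup>+t\<in>{s..x}. ennreal (p t * (w' t)\<^sup>2 / (x0 - t) powr (q - a)) \<partial>lborel)"
proof -
  define D where "D = x0 - x"
  have D: "D > 0" using sx by (simp add: D_def)
  define r where "r y = p y / (x0 - y) powr q" for y
  have r_le: "r x \<le> r t" if "t \<in> {s..x}" for t
    using monotone_onD[OF p_mono that] sx that by (simp add: r_def)
  have rx: "0 \<le> r x" using p_nonneg[of x] sx by (simp add: r_def)
  define J where "J = (\<integral>\<^sup>+t\<in>{s..x}. ennreal ((x0 - t) powr a * (w' t)\<^sup>2) \<partial>lborel)"
  have "set_borel_measurable borel {s..x} (\<lambda>t. (x0 - t) powr a * (w' t)\<^sup>2)"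
    by (intro set_borel_measurable_mult_square meas) (simp add: set_borel_measurable_def)
  then have "ennreal (r x) * J \<le> (\<integral>\<^sup>+t\<in>{s..x}. ennreal (r t * ((x0 - t) powr a * (w' t)\<^sup>2)) \<partial>lborel)"
    unfolding J_def using rx r_le by (intro set_nn_integral_mult_le) auto
  also have "\<dots> = (\<integral>\<^sup>+t\<in>{s..x}. ennreal (p t * (w' t)\<^sup>2 / (x0 - t) powr (q - a)) \<partial>lborel)"
    using sx by (intro set_nn_integral_cong) (auto simp: r_def powr_diff mult_ac)
  finally have rJ: "ennreal (r x) * J \<le> \<dots>" .
  have px: "p x / (x - x0)\<^sup>2 = r x * D powr (q - 2)"
    using D by (simp add: r_def D_def powr_diff power2_eq_square powr_numeral algebra_simps)
  have pw: "r x * D powr (q - 2) * (2 * D powr (1 - a) / (a - 1)) = 2 / (a - 1) * D powr (q - 1 - a) * r x"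
    using D by (simp add: powr_add[symmetric] field_simps)
  have "ennreal (p x / (x - x0)\<^sup>2 * (w x)\<^sup>2) = ennreal (r x * D powr (q - 2)) * ennreal ((w x)\<^sup>2)"
    unfolding px using rx by (simp add: ennreal_mult')
  also have "\<dots> \<le> ennreal (r x * D powr (q - 2)) * (ennreal (2 * (w s)\<^sup>2) + ennreal (2 * D powr (1 - a) / (a - 1)) * J)"
    using square_le_weighted_nn_integral[OF a sx ac N der meas] unfolding D_def J_def
    by (intro mult_left_mono) auto
  also have "\<dots> = ennreal (r x * D powr (q - 2) * (2 * (w s)\<^sup>2))
      + ennreal (2 / (a - 1) * D powr (q - 1 - a)) * (ennreal (r x) * J)"
  proof -
    have "0 \<le> r x * D powr (q - 2)" using rx by simp
    then show ?thesis
      by (simp only: distrib_left mult.assoc[symmetric] ennreal_mult'[symmetric] pw ennreal_mult''[OF rx])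
  qed
  also have "\<dots> \<le> ennreal (2 * (w s)\<^sup>2 * r s * D powr (q - 2))
      + ennreal (2 / (a - 1) * D powr (q - 1 - a))
        * (\<integral>\<^sup>+t\<in>{s..x}. ennreal (p t * (w' t)\<^sup>2 / (x0 - t) powr (q - a)) \<partial>lborel)"
  proof (rule add_mono)
    have "r x * D powr (q - 2) * (2 * (w s)\<^sup>2) \<le> r s * D powr (q - 2) * (2 * (w s)\<^sup>2)"
      using r_le[of s] sx by (intro mult_right_mono) auto
    then show "ennreal (r x * D powr (q - 2) * (2 * (w s)\<^sup>2)) \<le> ennreal (2 * (w s)\<^sup>2 * r s * D powr (q - 2))"
      by (intro ennreal_leI) (simp add: mult_ac)
  qed (use rJ in \<open>intro mult_left_mono, auto\<close>)
  finally show ?thesis by (simp add: r_def D_def)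
qed

lemma nn_integral_triangle_powr:
  fixes g :: "real \<Rightarrow> real"
  assumes g [measurable]: "g \<in> borel_measurable borel" and g_nonneg: "\<And>t. 0 \<le> g t" and e: "e > -1"
  shows "(\<integral>\<^sup>+x\<in>{s..<x0}. ennreal ((x0 - x) powr e)
            * (\<integral>\<^sup>+t\<in>{s..x}. ennreal (g t / (x0 - t) powr (e + 1)) \<partial>lborel) \<partial>lborel)
       = ennreal (1 / (e + 1)) * (\<integral>\<^sup>+t\<in>{s..<x0}. ennreal (g t) \<partial>lborel)"
proof -
  have "(\<lambda>x. ennreal ((x0 - x) powr e)) \<in> borel_measurable borel"
    by measurable
  from nn_integral_triangle_swap[OF _ this, of "\<lambda>t. ennreal (g t / (x0 - t) powr (e + 1))"]
  have "(\<integral>\<^sup>+x\<in>{s..<x0}. ennreal ((x0 - x) powr e)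
            * (\<integral>\<^sup>+t\<in>{s..x}. ennreal (g t / (x0 - t) powr (e + 1)) \<partial>lborel) \<partial>lborel)
      = (\<integral>\<^sup>+t\<in>{s..<x0}. ennreal (g t / (x0 - t) powr (e + 1)) * ennreal ((x0 - t) powr (e + 1) / (e + 1)) \<partial>lborel)"
    using nn_integral_powr_diff_Ico[OF e] by (auto intro!: set_nn_integral_cong)
  also have "\<dots> = (\<integral>\<^sup>+t. ennreal (1 / (e + 1)) * ennreal (g t) * indicator {s..<x0} t \<partial>lborel)"
    using e g_nonneg by (intro nn_integral_cong) (auto simp: indicator_def ennreal_mult'[symmetric])
  also have "\<dots> = ennreal (1 / (e + 1)) * (\<integral>\<^sup>+t\<in>{s..<x0}. ennreal (g t) \<partial>lborel)"
    by (subst nn_integral_cmult[symmetric]) (auto simp: mult.assoc)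
  finally show ?thesis .
qed

lemma nn_integral_hardy_kernel_le:
  fixes L g :: "real \<Rightarrow> real"
  assumes g [measurable]: "g \<in> borel_measurable borel" and g_nonneg: "\<And>t. 0 \<le> g t"
    and d: "d > -1" and e: "e > -1" and sx: "s \<le> x0" and c: "0 \<le> c" and \<beta>: "0 \<le> \<beta>"
    and bound: "\<And>x. x \<in> {s..<x0} \<Longrightarrow> ennreal (L x) \<le> ennreal (c * (x0 - x) powr d)
      + ennreal (\<beta> * (x0 - x) powr e) * (\<integral>\<^sup>+t\<in>{s..x}. ennreal (g t / (x0 - t) powr (e + 1)) \<partial>lborel)"
  shows "(\<integral>\<^sup>+x\<in>{s..<x0}. ennreal (L x) \<partial>lborel)
    \<le> ennreal (c * ((x0 - s) powr (d + 1) / (d + 1))) + ennreal (\<beta> / (e + 1)) * (\<integral>\<^sup>+t\<in>{s..<x0}. ennreal (g t) \<partial>lborel)"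
proof -
  define F where "F x = (\<integral>\<^sup>+t\<in>{s..x}. ennreal (g t / (x0 - t) powr (e + 1)) \<partial>lborel)" for x
  have [measurable]: "Measurable.pred (borel \<Otimes>\<^sub>M borel) (\<lambda>xt :: real \<times> real. snd xt \<in> {s..fst xt})"
    unfolding atLeastAtMost_iff by measurable
  have [measurable]: "F \<in> borel_measurable borel"
    unfolding F_def by measurable
  have "(\<integral>\<^sup>+x\<in>{s..<x0}. ennreal (L x) \<partial>lborel)
      \<le> (\<integral>\<^sup>+x. ennreal c * (ennreal ((x0 - x) powr d) * indicator {s..<x0} x)
        + ennreal \<beta> * (ennreal ((x0 - x) powr e) * F x * indicator {s..<x0} x) \<partial>lborel)"
    using bound c \<beta> unfolding F_def
    by (intro nn_integral_mono) (auto simp: indicator_def ennreal_mult' mult.assoc)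
  also have "\<dots> = ennreal c * (\<integral>\<^sup>+x\<in>{s..<x0}. ennreal ((x0 - x) powr d) \<partial>lborel)
      + ennreal \<beta> * (\<integral>\<^sup>+x\<in>{s..<x0}. ennreal ((x0 - x) powr e) * F x \<partial>lborel)"
    by (simp add: nn_integral_add nn_integral_cmult)
  also have "\<dots> = ennreal c * ennreal ((x0 - s) powr (d + 1) / (d + 1))
      + ennreal \<beta> * (ennreal (1 / (e + 1)) * (\<integral>\<^sup>+t\<in>{s..<x0}. ennreal (g t) \<partial>lborel))"
    unfolding F_def nn_integral_triangle_powr[OF g g_nonneg e] nn_integral_powr_diff_Ico[OF d sx] ..
  also have "\<dots> = ennreal (c * ((x0 - s) powr (d + 1) / (d + 1)))
      + ennreal (\<beta> / (e + 1)) * (\<integral>\<^sup>+t\<in>{s..<x0}. ennreal (g t) \<partial>lborel)"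
    by (simp only: mult.assoc[symmetric] ennreal_mult'[OF c, symmetric] ennreal_mult'[OF \<beta>, symmetric], simp)
  finally show ?thesis .
qed

lemma hardy_inequality_left:
  fixes p w w' :: "real \<Rightarrow> real"
  assumes sx: "s < x0" and q: "q > 1"
    and p_cont: "continuous_on {s..<x0} p" and p_nonneg: "\<And>x. x \<in> {s..<x0} \<Longrightarrow> 0 \<le> p x"
    and p_mono: "antimono_on {s..<x0} (\<lambda>x. p x / \<bar>x - x0\<bar> powr q)"
    and ac: "\<And>b. s \<le> b \<Longrightarrow> b < x0 \<Longrightarrow> abs_continuous_on w s b"
    and N: "negligible N"
    and der: "\<And>x. x \<in> {s..<x0} - N \<Longrightarrow> (w has_real_derivative w' x) (at x)"
    and meas: "set_borel_measurable borel {s..<x0} w'"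
  shows "(\<integral>\<^sup>+x\<in>{s..<x0}. ennreal (p x / (x - x0)\<^sup>2 * (w x)\<^sup>2) \<partial>lborel)
    \<le> ennreal (8 / (q - 1)\<^sup>2) * (\<integral>\<^sup>+x\<in>{s..<x0}. ennreal (p x * (w' x)\<^sup>2) \<partial>lborel)
      + ennreal (2 * (x0 - s) powr (q - 1) / (q - 1) * ((w s)\<^sup>2 * p s / (x0 - s) powr q))"
proof -
  \<comment> \<open>The weight exponent \<open>a\<close> of the Cauchy--Schwarz step is chosen to minimise the constant.\<close>
  define a where "a = (q + 1) / 2"
  have a: "a > 1" "q - 1 - a > -1" "2 / (a - 1) / (q - 1 - a + 1) = 8 / (q - 1)\<^sup>2"
    using q by (auto simp: a_def power2_eq_square field_simps)
  define c where "c = 2 * (w s)\<^sup>2 * (p s / (x0 - s) powr q)"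
  define g where "g t = indicator {s..<x0} t * (p t * (w' t)\<^sup>2)" for t
  have "set_borel_measurable borel {s..<x0} (\<lambda>t. p t * (w' t)\<^sup>2)"
    using p_cont by (intro set_borel_measurable_mult_square set_borel_measurable_continuous_on meas) auto
  then have g_meas: "g \<in> borel_measurable borel"
    unfolding g_def set_borel_measurable_def by simp
  have g_nonneg: "0 \<le> g t" for t
    using p_nonneg[of t] by (simp add: g_def indicator_def)
  have "ennreal (p x / (x - x0)\<^sup>2 * (w x)\<^sup>2) \<le> ennreal (c * (x0 - x) powr (q - 2))
      + ennreal (2 / (a - 1) * (x0 - x) powr (q - 1 - a))
        * (\<integral>\<^sup>+t\<in>{s..x}. ennreal (g t / (x0 - t) powr (q - 1 - a + 1)) \<partial>lborel)"
    if x: "x \<in> {s..<x0}" for x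
  proof -
    have mono: "antimono_on {s..x} (\<lambda>y. p y / (x0 - y) powr q)"
    proof (rule monotone_onI)
      fix y z assume "y \<in> {s..x}" "z \<in> {s..x}" "y \<le> z"
      then show "p z / (x0 - z) powr q \<le> p y / (x0 - y) powr q"
        using monotone_onD[OF p_mono, of y z] x by auto
    qed
    have meas_x: "set_borel_measurable borel {s..x} w'"
      using x by (intro set_borel_measurable_subset[OF meas]) auto
    have "ennreal (p x / (x - x0)\<^sup>2 * (w x)\<^sup>2) \<le> ennreal (c * (x0 - x) powr (q - 2))
        + ennreal (2 / (a - 1) * (x0 - x) powr (q - 1 - a))
          * (\<integral>\<^sup>+t\<in>{s..x}. ennreal (p t * (w' t)\<^sup>2 / (x0 - t) powr (q - a)) \<partial>lborel)"
      unfolding c_def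
      by (rule hardy_integrand_le[OF a(1) _ _ _ mono ac N _ meas_x]) (use x p_nonneg der in auto)
    also have "(\<integral>\<^sup>+t\<in>{s..x}. ennreal (p t * (w' t)\<^sup>2 / (x0 - t) powr (q - a)) \<partial>lborel)
        = (\<integral>\<^sup>+t\<in>{s..x}. ennreal (g t / (x0 - t) powr (q - 1 - a + 1)) \<partial>lborel)"
      using x by (intro set_nn_integral_cong) (auto simp: g_def)
    finally show ?thesis .
  qed
  then have "(\<integral>\<^sup>+x\<in>{s..<x0}. ennreal (p x / (x - x0)\<^sup>2 * (w x)\<^sup>2) \<partial>lborel)
      \<le> ennreal (c * ((x0 - s) powr (q - 2 + 1) / (q - 2 + 1)))
        + ennreal (2 / (a - 1) / (q - 1 - a + 1)) * (\<integral>\<^sup>+t\<in>{s..<x0}. ennreal (g t) \<partial>lborel)"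
    using p_nonneg[of s] sx q a(1)
    by (intro nn_integral_hardy_kernel_le[OF g_meas g_nonneg _ a(2)]) (auto simp: c_def)
  also have "(\<integral>\<^sup>+t\<in>{s..<x0}. ennreal (g t) \<partial>lborel) = (\<integral>\<^sup>+x\<in>{s..<x0}. ennreal (p x * (w' x)\<^sup>2) \<partial>lborel)"
    by (intro set_nn_integral_cong) (auto simp: g_def)
  also have "c * ((x0 - s) powr (q - 2 + 1) / (q - 2 + 1))
      = 2 * (x0 - s) powr (q - 1) / (q - 1) * ((w s)\<^sup>2 * p s / (x0 - s) powr q)"
    by (simp add: c_def mult_ac)
  finally show ?thesis
    unfolding a(3) by (simp add: add.commute)
qed

section \<open>The two-sided Hardy inequality\<close>

lemma continuous_on_Ico_if_Icc:
  fixes f :: "real \<Rightarrow> 'a::topological_space"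
  assumes "\<And>b. s \<le> b \<Longrightarrow> b < c \<Longrightarrow> continuous_on {s..b} f"
  shows "continuous_on {s..<c} f"
  unfolding continuous_on_eq_continuous_within
proof
  fix x assume x: "x \<in> {s..<c}"
  define b where "b = (x + c) / 2"
  have b: "s \<le> b" "b < c" "x < b" using x by (auto simp: b_def)
  have "continuous (at x within {s..b}) f"
    using assms[OF b(1,2)] x b(3) by (simp add: continuous_on_eq_continuous_within)
  moreover have "at x within {s..<c} = at x within {s..b}"
    by (rule at_within_nhd[of x "{..<b}"]) (use b in auto)
  ultimately show "continuous (at x within {s..<c}) f" by simp
qed

lemma continuous_on_Ioc_if_Icc:
  fixes f :: "real \<Rightarrow> 'a::topological_space"
  assumes "\<And>a. c < a \<Longrightarrow> a \<le> t \<Longrightarrow> continuous_on {a..t} f"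
  shows "continuous_on {c<..t} f"
  unfolding continuous_on_eq_continuous_within
proof
  fix x assume x: "x \<in> {c<..t}"
  define a where "a = (x + c) / 2"
  have a: "c < a" "a \<le> t" "a < x" using x by (auto simp: a_def)
  have "continuous (at x within {a..t}) f"
    using assms[OF a(1,2)] x a(3) by (simp add: continuous_on_eq_continuous_within)
  moreover have "at x within {c<..t} = at x within {a..t}"
    by (rule at_within_nhd[of x "{a<..}"]) (use a in auto)
  ultimately show "continuous (at x within {c<..t}) f" by simp
qed

lemma set_nn_integral_lborel_reflect:
  fixes f :: "real \<Rightarrow> ennreal"
  assumes "(\<lambda>x. f x * indicator A x) \<in> borel_measurable borel"
  shows "(\<integral>\<^sup>+x\<in>A. f x \<partial>lborel) = (\<integral>\<^sup>+x\<in>uminus ` A. f (- x) \<partial>lborel)"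
proof -
  have "(\<integral>\<^sup>+x\<in>A. f x \<partial>lborel) = (\<integral>\<^sup>+x\<in>A. f x \<partial>distr lborel borel uminus)"
    by (simp add: lborel_distr_uminus)
  also have "\<dots> = (\<integral>\<^sup>+x. f (- x) * indicator A (- x) \<partial>lborel)"
    using assms by (intro nn_integral_distr) auto
  also have "\<dots> = (\<integral>\<^sup>+x\<in>uminus ` A. f (- x) \<partial>lborel)"
    by (intro nn_integral_cong) (auto simp: indicator_def image_iff)
  finally show ?thesis .
qed

lemma negligible_uminus_image:
  fixes N :: "real set"
  assumes "negligible N"
  shows "negligible (uminus ` N)"
  by (rule negligible_differentiable_image_negligible[OF _ assms]) (auto intro: derivative_intros)

lemma hardy_inequality_right:
  fixes p w w' :: "real \<Rightarrow> real"
  assumes xt: "x0 < t" and q: "q > 1"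
    and p_cont: "continuous_on {x0<..t} p" and p_nonneg: "\<And>x. x \<in> {x0<..t} \<Longrightarrow> 0 \<le> p x"
    and p_mono: "mono_on {x0<..t} (\<lambda>x. p x / \<bar>x - x0\<bar> powr q)"
    and ac: "\<And>a. x0 < a \<Longrightarrow> a \<le> t \<Longrightarrow> abs_continuous_on w a t"
    and N: "negligible N"
    and der: "\<And>x. x \<in> {x0<..t} - N \<Longrightarrow> (w has_real_derivative w' x) (at x)"
    and meas: "set_borel_measurable borel {x0<..t} w'"
  shows "(\<integral>\<^sup>+x\<in>{x0<..t}. ennreal (p x / (x - x0)\<^sup>2 * (w x)\<^sup>2) \<partial>lborel)
    \<le> ennreal (8 / (q - 1)\<^sup>2) * (\<integral>\<^sup>+x\<in>{x0<..t}. ennreal (p x * (w' x)\<^sup>2) \<partial>lborel)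
      + ennreal (2 * (t - x0) powr (q - 1) / (q - 1) * ((w t)\<^sup>2 * p t / (t - x0) powr q))"
proof -
  have w_cont: "continuous_on {x0<..t} w"
    using ac abs_continuous_on_imp_continuous_on by (intro continuous_on_Ioc_if_Icc) blast
  have "set_borel_measurable borel {x0<..t} (\<lambda>x. p x / (x - x0)\<^sup>2 * (w x)\<^sup>2)"
    using p_cont w_cont by (intro set_borel_measurable_continuous_on continuous_intros) auto
  then have lhs: "(\<integral>\<^sup>+x\<in>{x0<..t}. ennreal (p x / (x - x0)\<^sup>2 * (w x)\<^sup>2) \<partial>lborel)
      = (\<integral>\<^sup>+y\<in>{-t..<-x0}. ennreal (p (- y) / (y - - x0)\<^sup>2 * (w (- y))\<^sup>2) \<partial>lborel)"
    by (subst set_nn_integral_lborel_reflect[OF borel_measurable_ennreal_indicator])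
      (auto simp: power2_eq_square algebra_simps)
  have "set_borel_measurable borel {x0<..t} (\<lambda>x. p x * (w' x)\<^sup>2)"
    using p_cont by (intro set_borel_measurable_mult_square set_borel_measurable_continuous_on meas) auto
  then have rhs: "(\<integral>\<^sup>+x\<in>{x0<..t}. ennreal (p x * (w' x)\<^sup>2) \<partial>lborel)
      = (\<integral>\<^sup>+y\<in>{-t..<-x0}. ennreal (p (- y) * (- w' (- y))\<^sup>2) \<partial>lborel)"
    by (subst set_nn_integral_lborel_reflect[OF borel_measurable_ennreal_indicator]) auto
  have "(\<integral>\<^sup>+y\<in>{-t..<-x0}. ennreal (p (- y) / (y - - x0)\<^sup>2 * (w (- y))\<^sup>2) \<partial>lborel)
    \<le> ennreal (8 / (q - 1)\<^sup>2) * (\<integral>\<^sup>+y\<in>{-t..<-x0}. ennreal (p (- y) * (- w' (- y))\<^sup>2) \<partial>lborel)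
      + ennreal (2 * (- x0 - - t) powr (q - 1) / (q - 1) * ((w (- (- t)))\<^sup>2 * p (- (- t)) / (- x0 - - t) powr q))"
  proof (rule hardy_inequality_left[where N = "uminus ` N"])
    show "continuous_on {-t..<-x0} (\<lambda>y. p (- y))"
      using p_cont by (intro continuous_on_compose2[OF p_cont]) (auto intro: continuous_intros)
    show "antimono_on {-t..<-x0} (\<lambda>y. p (- y) / \<bar>y - - x0\<bar> powr q)"
    proof (rule monotone_onI)
      fix y z assume "y \<in> {-t..<-x0}" "z \<in> {-t..<-x0}" "y \<le> z"
      then have "p (- z) / \<bar>- z - x0\<bar> powr q \<le> p (- y) / \<bar>- y - x0\<bar> powr q"
        by (intro monotone_onD[OF p_mono]) auto
      moreover have "\<bar>- z - x0\<bar> = \<bar>z - - x0\<bar>" "\<bar>- y - x0\<bar> = \<bar>y - - x0\<bar>"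
        by auto
      ultimately show "p (- z) / \<bar>z - - x0\<bar> powr q \<le> p (- y) / \<bar>y - - x0\<bar> powr q"
        by simp
    qed
    show "abs_continuous_on (\<lambda>y. w (- y)) (- t) b" if "- t \<le> b" "b < - x0" for b
      using abs_continuous_on_reflect[OF ac[of "- b"]] that by simp
    show "negligible (uminus ` N)" by (rule negligible_uminus_image[OF N])
    show "((\<lambda>y. w (- y)) has_real_derivative - w' (- y)) (at y)" if "y \<in> {-t..<-x0} - uminus ` N" for y
      using der[of "- y"] that by (auto simp: DERIV_mirror image_iff) (metis minus_minus)
    have "(\<lambda>y. - (indicator {x0<..t} (- y) *\<^sub>R w' (- y))) \<in> borel_measurable borel"
      using meas unfolding set_borel_measurable_def by measurable
    then show "set_borel_measurable borel {-t..<-x0} (\<lambda>y. - w' (- y))"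
      unfolding set_borel_measurable_def
      by (rule measurable_cong[THEN iffD1, rotated]) (auto simp: indicator_def)
  qed (use xt q p_nonneg in auto)
  then show ?thesis
    unfolding lhs rhs by simp
qed

lemma set_nn_integral_Icc_split:
  fixes g :: "real \<Rightarrow> real"
  assumes "a \<le> c" "c \<le> b"
    and "set_borel_measurable borel {a..<c} g" "set_borel_measurable borel {c<..b} g"
  shows "(\<integral>\<^sup>+x\<in>{a..b}. ennreal (g x) \<partial>lborel)
    = (\<integral>\<^sup>+x\<in>{a..<c}. ennreal (g x) \<partial>lborel) + (\<integral>\<^sup>+x\<in>{c<..b}. ennreal (g x) \<partial>lborel)"
proof -
  have "(\<integral>\<^sup>+x\<in>{a..b}. ennreal (g x) \<partial>lborel)
      = (\<integral>\<^sup>+x. ennreal (g x) * indicator {a..<c} x + ennreal (g x) * indicator {c<..b} x \<partial>lborel)"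
    using AE_lborel_singleton[of c] assms(1,2)
    by (intro nn_integral_cong_AE) (auto elim!: eventually_mono simp: indicator_def)
  also have "\<dots> = (\<integral>\<^sup>+x\<in>{a..<c}. ennreal (g x) \<partial>lborel) + (\<integral>\<^sup>+x\<in>{c<..b}. ennreal (g x) \<partial>lborel)"
    using borel_measurable_ennreal_indicator[OF assms(3)] borel_measurable_ennreal_indicator[OF assms(4)]
    by (intro nn_integral_add) auto
  finally show ?thesis .
qed

lemma hardy_inequality:
  fixes p w w' :: "real \<Rightarrow> real"
  assumes ab: "a < x0" "x0 < b" and q: "q > 1"
    and p_cont: "continuous_on {a..b} p" and p_nonneg: "\<And>x. x \<in> {a..b} \<Longrightarrow> 0 \<le> p x"
    and p_mono_left: "antimono_on {a..<x0} (\<lambda>x. p x / \<bar>x - x0\<bar> powr q)"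
    and p_mono_right: "mono_on {x0<..b} (\<lambda>x. p x / \<bar>x - x0\<bar> powr q)"
    and ac: "\<And>c d. (a \<le> c \<and> d < x0) \<or> (x0 < c \<and> d \<le> b) \<Longrightarrow> abs_continuous_on w c d"
    and N: "negligible N"
    and der: "\<And>x. x \<in> {a..b} - N \<Longrightarrow> (w has_real_derivative w' x) (at x)"
    and meas: "set_borel_measurable borel {a..b} w'"
  shows "(\<integral>\<^sup>+x\<in>{a..b}. ennreal (p x / (x - x0)\<^sup>2 * (w x)\<^sup>2) \<partial>lborel)
    \<le> ennreal (8 / (q - 1)\<^sup>2) * (\<integral>\<^sup>+x\<in>{a..b}. ennreal (p x * (w' x)\<^sup>2) \<partial>lborel)
      + ennreal (2 * (x0 - a) powr (q - 1) / (q - 1) * ((w a)\<^sup>2 * p a / (x0 - a) powr q)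
        + 2 * (b - x0) powr (q - 1) / (q - 1) * ((w b)\<^sup>2 * p b / (b - x0) powr q))"
proof -
  have meas_left: "set_borel_measurable borel {a..<x0} w'" and meas_right: "set_borel_measurable borel {x0<..b} w'"
    using ab by (auto intro!: set_borel_measurable_subset[OF meas])
  have w_cont: "continuous_on {a..<x0} w" "continuous_on {x0<..b} w"
    using ac abs_continuous_on_imp_continuous_on
    by (auto intro!: continuous_on_Ico_if_Icc continuous_on_Ioc_if_Icc)
  have p_cont': "continuous_on {a..<x0} p" "continuous_on {x0<..b} p"
    using ab by (auto intro: continuous_on_subset[OF p_cont])
  have lhs: "(\<integral>\<^sup>+x\<in>{a..b}. ennreal (p x / (x - x0)\<^sup>2 * (w x)\<^sup>2) \<partial>lborel)
      = (\<integral>\<^sup>+x\<in>{a..<x0}. ennreal (p x / (x - x0)\<^sup>2 * (w x)\<^sup>2) \<partial>lborel)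
        + (\<integral>\<^sup>+x\<in>{x0<..b}. ennreal (p x / (x - x0)\<^sup>2 * (w x)\<^sup>2) \<partial>lborel)"
    using ab w_cont p_cont'
    by (intro set_nn_integral_Icc_split set_borel_measurable_continuous_on continuous_intros) auto
  have rhs: "(\<integral>\<^sup>+x\<in>{a..b}. ennreal (p x * (w' x)\<^sup>2) \<partial>lborel)
      = (\<integral>\<^sup>+x\<in>{a..<x0}. ennreal (p x * (w' x)\<^sup>2) \<partial>lborel)
        + (\<integral>\<^sup>+x\<in>{x0<..b}. ennreal (p x * (w' x)\<^sup>2) \<partial>lborel)"
    using ab p_cont'
    by (intro set_nn_integral_Icc_split set_borel_measurable_mult_square meas_left meas_right
        set_borel_measurable_continuous_on) auto
  have left: "(\<integral>\<^sup>+x\<in>{a..<x0}. ennreal (p x / (x - x0)\<^sup>2 * (w x)\<^sup>2) \<partial>lborel)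
    \<le> ennreal (8 / (q - 1)\<^sup>2) * (\<integral>\<^sup>+x\<in>{a..<x0}. ennreal (p x * (w' x)\<^sup>2) \<partial>lborel)
      + ennreal (2 * (x0 - a) powr (q - 1) / (q - 1) * ((w a)\<^sup>2 * p a / (x0 - a) powr q))"
    using ab p_nonneg der
    by (intro hardy_inequality_left[OF ab(1) q p_cont'(1) _ p_mono_left _ N _ meas_left] ac) auto
  have right: "(\<integral>\<^sup>+x\<in>{x0<..b}. ennreal (p x / (x - x0)\<^sup>2 * (w x)\<^sup>2) \<partial>lborel)
    \<le> ennreal (8 / (q - 1)\<^sup>2) * (\<integral>\<^sup>+x\<in>{x0<..b}. ennreal (p x * (w' x)\<^sup>2) \<partial>lborel)
      + ennreal (2 * (b - x0) powr (q - 1) / (q - 1) * ((w b)\<^sup>2 * p b / (b - x0) powr q))"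
    using ab p_nonneg der
    by (intro hardy_inequality_right[OF ab(2) q p_cont'(2) _ p_mono_right _ N _ meas_right] ac) auto
  have boundary_nonneg: "0 \<le> 2 * (x0 - a) powr (q - 1) / (q - 1) * ((w a)\<^sup>2 * p a / (x0 - a) powr q)"
    "0 \<le> 2 * (b - x0) powr (q - 1) / (q - 1) * ((w b)\<^sup>2 * p b / (b - x0) powr q)"
    using ab q p_nonneg[of a] p_nonneg[of b] by auto
  show ?thesis
    unfolding lhs rhs distrib_left ennreal_plus[OF boundary_nonneg]
    using add_mono[OF left right] by (simp add: ac_simps)
qed

lemma AE_lborel_negligibleE:
  assumes "AE x in lborel. P (x :: 'a::euclidean_space)"
  obtains N where "negligible N" "\<And>x. x \<notin> N \<Longrightarrow> P x"
proof -
  obtain N where "N \<in> null_sets lborel" "\<And>x. x \<in> space lborel - N \<Longrightarrow> P x"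
    using AE_E3[OF assms] by blast
  moreover have "negligible N"
    using \<open>N \<in> null_sets lborel\<close> unfolding negligible_iff_null_sets by (rule null_sets_completionI)
  ultimately show thesis using that by auto
qed

lemma boundary_weights_le_max:
  fixes x0 q A B :: real
  assumes x0: "0 < x0" "x0 < 1" and q: "q > 1" and AB: "0 \<le> A" "0 \<le> B"
  shows "2 * x0 powr (q - 1) / (q - 1) * B + 2 * (1 - x0) powr (q - 1) / (q - 1) * A
    \<le> 2 * max ((1 - x0) powr (q - 1) / (q - 1)) (1 / (q - 1)) * (A + B)"
proof -
  define \<Xi> where "\<Xi> = max ((1 - x0) powr (q - 1) / (q - 1)) (1 / (q - 1))"
  have "x0 powr (q - 1) \<le> 1 powr (q - 1)"
    using x0 q by (intro powr_mono2) auto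
  then have "x0 powr (q - 1) / (q - 1) \<le> \<Xi>"
    using q unfolding \<Xi>_def by (auto intro: order_trans[OF divide_right_mono])
  moreover have "(1 - x0) powr (q - 1) / (q - 1) \<le> \<Xi>"
    unfolding \<Xi>_def by simp
  ultimately have "x0 powr (q - 1) / (q - 1) * B + (1 - x0) powr (q - 1) / (q - 1) * A \<le> \<Xi> * A + \<Xi> * B"
    using mult_right_mono[of _ \<Xi> B] mult_right_mono[of _ \<Xi> A] AB by fastforce
  then show ?thesis
    unfolding \<Xi>_def[symmetric] times_divide_eq_right[symmetric] mult.assoc distrib_left by linarith
qed

theorem proposition2p9:
  fixes p :: "real \<Rightarrow> real" and x0 q :: real
  assumes x0: "0 < x0" "x0 < 1"
    and p_cont: "continuous_on {0..1} p"
    and p_pos: "\<forall>x\<in>{0..1} - {x0}. p x > 0"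
    and p_x0: "p x0 = 0"
    and q: "q > 1"
    and p_mono_left: "antimono_on {0..<x0} (\<lambda>x. p x / \<bar>x - x0\<bar> powr q)"
    and p_mono_right: "mono_on {x0<..1} (\<lambda>x. p x / \<bar>x - x0\<bar> powr q)"
  shows "\<exists>C_HP > 0. \<forall>(w::real \<Rightarrow> real) (w'::real \<Rightarrow> real).
      loc_abs_continuous_punctured w x0 \<longrightarrow>
      set_borel_measurable lborel {0..1} w' \<longrightarrow>
      (AE x in lborel. x \<in> {0..1} \<longrightarrow> (w has_real_derivative w' x) (at x)) \<longrightarrow>
      (w has_real_derivative 0) (at_right 0) \<longrightarrow>
      (w has_real_derivative 0) (at_left 1) \<longrightarrow>
      (\<integral>\<^sup>+ x\<in>{0..1}. ennreal ((w' x)\<^sup>2) \<partial>lborel) < \<infinity> \<longrightarrow>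
      (\<integral>\<^sup>+ x\<in>{0..1}. ennreal (p x / (x - x0)\<^sup>2 * (w x)\<^sup>2) \<partial>lborel)
        \<le> ennreal C_HP * (\<integral>\<^sup>+ x\<in>{0..1}. ennreal (p x * (w' x)\<^sup>2) \<partial>lborel)
           + ennreal (2 * max ((1 - x0) powr (q - 1) / (q - 1)) (1 / (q - 1))
               * ((w 1)\<^sup>2 * p 1 / (1 - x0) powr q + (w 0)\<^sup>2 * p 0 / x0 powr q))"
proof (intro exI[of _ "8 / (q - 1)\<^sup>2"] conjI allI impI)
  show "8 / (q - 1)\<^sup>2 > 0" using q by simp
  fix w w' :: "real \<Rightarrow> real"
  assume ac: "loc_abs_continuous_punctured w x0"
    and meas: "set_borel_measurable lborel {0..1} w'"
    and der: "AE x in lborel. x \<in> {0..1} \<longrightarrow> (w has_real_derivative w' x) (at x)"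
  obtain N where N: "negligible N" "\<And>x. x \<in> {0..1} - N \<Longrightarrow> (w has_real_derivative w' x) (at x)"
    using AE_lborel_negligibleE[OF der] by (metis Diff_iff)
  have ac': "abs_continuous_on w c d" if "(0 \<le> c \<and> d < x0) \<or> (x0 < c \<and> d \<le> 1)" for c d
    using ac that unfolding loc_abs_continuous_punctured_def by blast
  have p_nonneg: "0 \<le> p x" if "x \<in> {0..1}" for x
    using p_pos p_x0 that by (cases "x = x0") (auto intro!: less_imp_le)
  have "(\<integral>\<^sup>+ x\<in>{0..1}. ennreal (p x / (x - x0)\<^sup>2 * (w x)\<^sup>2) \<partial>lborel)
      \<le> ennreal (8 / (q - 1)\<^sup>2) * (\<integral>\<^sup>+ x\<in>{0..1}. ennreal (p x * (w' x)\<^sup>2) \<partial>lborel)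
        + ennreal (2 * x0 powr (q - 1) / (q - 1) * ((w 0)\<^sup>2 * p 0 / x0 powr q)
          + 2 * (1 - x0) powr (q - 1) / (q - 1) * ((w 1)\<^sup>2 * p 1 / (1 - x0) powr q))"
    using hardy_inequality[OF x0 q p_cont p_nonneg p_mono_left p_mono_right ac' N] meas
    by (simp add: set_borel_measurable_def)
  also have "\<dots> \<le> ennreal (8 / (q - 1)\<^sup>2) * (\<integral>\<^sup>+ x\<in>{0..1}. ennreal (p x * (w' x)\<^sup>2) \<partial>lborel)
      + ennreal (2 * max ((1 - x0) powr (q - 1) / (q - 1)) (1 / (q - 1))
          * ((w 1)\<^sup>2 * p 1 / (1 - x0) powr q + (w 0)\<^sup>2 * p 0 / x0 powr q))"
    using x0 q p_nonneg[of 0] p_nonneg[of 1]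
    by (intro add_left_mono ennreal_leI boundary_weights_le_max) auto
  finally show "(\<integral>\<^sup>+ x\<in>{0..1}. ennreal (p x / (x - x0)\<^sup>2 * (w x)\<^sup>2) \<partial>lborel)
      \<le> ennreal (8 / (q - 1)\<^sup>2) * (\<integral>\<^sup>+ x\<in>{0..1}. ennreal (p x * (w' x)\<^sup>2) \<partial>lborel)
        + ennreal (2 * max ((1 - x0) powr (q - 1) / (q - 1)) (1 / (q - 1))
            * ((w 1)\<^sup>2 * p 1 / (1 - x0) powr q + (w 0)\<^sup>2 * p 0 / x0 powr q))" .
qed

end
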